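(* Let $Z_1$ and $Z_2$ be finite binary strings. If $EM(Z_1) = EM(Z_2)$ (as infinite binary sequences), then $Z_1 = Z_2$.
   Context: All strings are over the alphabet $\{0,1\}$; for a digit $y$, $y' = 1-y$. Definition of $EM(Z)$ for a finite binary string $Z$ (the seed, possibly empty): it is the infinite binary sequence $x_1x_2x_3\dots$ generated digit by digit as follows. Suppose $x_1,\dots,x_k$ ($k\ge 0$) have been generated and let $W = Zx_1\cdots x_k$ (concatenation). If $W$ is empty (i.e. $Z$ is empty and $k=0$), put $x_1 = 0$. Otherwise let $\sigma$ be the longest tail (suffix, possibly empty) of $W$ that also occurs as a substring of $W$ with its last digit removed. Take the latest (rightmost) such earlier occurrence and let $y$ be the digit of $W$ immediately following it; if $\sigma$ is empty, the latest previous occurrence is understood to be just before the last digit of $W$, so $y$ is the last digit of $W$. Then $x_{k+1} = y'$. The sequence $EM(Z)$ does not include the seed $Z$. *)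

theory Defs
  imports Main "HOL-Library.Sublist"
begin

text \<open>
  Binary strings are lists of type \<^typ>\<open>bool list\<close>, with \<^const>\<open>False\<close> for the digit 0 and
  \<^const>\<open>True\<close> for the digit 1; the complement of a digit is its negation.
\<close>

definition occurs_at :: "'a list \<Rightarrow> nat \<Rightarrow> 'a list \<Rightarrow> bool" where
  "occurs_at u i w \<longleftrightarrow> (\<exists>p q. w = p @ u @ q \<and> length p = i)"

text \<open>Meaningful for nonempty \<open>W\<close> only: then the empty string is always a candidate.\<close>

definition em_tail :: "bool list \<Rightarrow> bool list" where
  "em_tail W = (ARG_MAX length s. suffix s W \<and> sublist s (butlast W))"

definition em_pos :: "bool list \<Rightarrow> nat" where
  "em_pos W = (GREATEST i. occurs_at (em_tail W) i (butlast W))"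

text \<open>
  The occurrence lies in \<^term>\<open>butlast W\<close>, so the index below is less than \<^term>\<open>length W\<close>.
  If the tail is empty, the latest occurrence is at position \<^term>\<open>length W - 1\<close>, and the
  digit following it is the last digit of \<open>W\<close>.
\<close>

definition em_next :: "bool list \<Rightarrow> bool" where
  "em_next W = (if W = [] then False else \<not> W ! (em_pos W + length (em_tail W)))"

text \<open>\<open>em_word Z k\<close> is the seed \<open>Z\<close> followed by the first \<open>k\<close> generated digits.\<close>

primrec em_word :: "bool list \<Rightarrow> nat \<Rightarrow> bool list" where
  "em_word Z 0 = Z"
| "em_word Z (Suc k) = em_word Z k @ [em_next (em_word Z k)]"

text \<open>Indexed from 0: \<open>EM Z k\<close> is the digit \<open>x\<^bsub>k+1\<^esub>\<close>. The seed is not included.\<close>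

definition EM :: "bool list \<Rightarrow> nat \<Rightarrow> bool" where
  "EM Z k = em_next (em_word Z k)"

end

(*
  Let V be the longest common suffix of the seeds and X the common sequence, and compare the
  words Z1 X and Z2 X, which agree from V on. For large n look at the first time a factor of
  length n of V X is repeated. Since X is not eventually periodic, the rule forces this repeated
  factor to be the prefix of V X of length n, and the letter preceding its second occurrence to
  differ from the letter preceding V in either seed. If both seeds are longer than V, those two
  letters already exhaust the alphabet. If one of them is V itself, the prefix of length n occurs
  twice more before the first repeat of length n + 1 is complete, both times preceded by the same
  letter, which gives an earlier repeat of length n + 1.
*)

theory Submission
  imports Defs
begin

section \<open>Words on the integers and the generation rule\<close>

text \<open>Position 0 is the first letter of the common suffix \<open>V\<close> of the seeds; the rest of a seed
  occupies the negative positions from \<open>lo\<close> on, and values below \<open>lo\<close> are junk.\<close>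

definition agree :: "(int \<Rightarrow> 'a) \<Rightarrow> int \<Rightarrow> int \<Rightarrow> int \<Rightarrow> int \<Rightarrow> bool" where
  "agree w lo e N l \<longleftrightarrow> lo \<le> e - l \<and> (\<forall>t. 1 \<le> t \<and> t \<le> l \<longrightarrow> w (e - t) = w (N - t))"

text \<open>"Longest, then latest" without extrema: given any match at \<open>e\<close>, the rule
  follows the opposite of the letter after a match that is longer or ends no earlier. The first
  generated digit sits at \<open>z\<close>, so the condition starts at the second.\<close>

definition em_rule :: "(int \<Rightarrow> bool) \<Rightarrow> int \<Rightarrow> int \<Rightarrow> bool" where
  "em_rule w lo z \<longleftrightarrow> (\<forall>N>z. \<forall>e<N. \<forall>l\<ge>0. agree w lo e N l \<longrightarrow>
     (\<exists>e1<N. agree w lo e1 N l \<and> w e1 \<noteq> w N \<and> (e \<le> e1 \<or> agree w lo e1 N (l + 1))))"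

lemma em_ruleE:
  assumes "em_rule w lo z" "N > z" "e < N" "l \<ge> 0" "agree w lo e N l"
  obtains e1 where "e1 < N" "agree w lo e1 N l" "w e1 \<noteq> w N"
    "e \<le> e1 \<or> agree w lo e1 N (l + 1)"
  using assms unfolding em_rule_def by blast

lemma agree_mono: "agree w lo e N l \<Longrightarrow> lo' \<le> lo \<Longrightarrow> l' \<le> l \<Longrightarrow> agree w lo' e N l'"
  unfolding agree_def by auto

lemma agreeD: "agree w lo e N l \<Longrightarrow> 1 \<le> t \<Longrightarrow> t \<le> l \<Longrightarrow> w (e - t) = w (N - t)"
  unfolding agree_def by auto

lemma agree_extend:
  assumes "agree w lo e N l" "lo \<le> e - (l + 1)" "w (e - (l + 1)) = w (N - (l + 1))"
  shows "agree w lo e N (l + 1)"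
  unfolding agree_def
proof (intro conjI allI impI)
  fix t assume "1 \<le> t \<and> t \<le> l + 1"
  then show "w (e - t) = w (N - t)"
    using assms(1,3) unfolding agree_def by (cases "t = l + 1") auto
qed (use assms in simp)

lemma agree_common:
  assumes "agree w lo e N l" "agree w lo e' N l" shows "agree w lo e e' l"
  using assms unfolding agree_def by auto

text \<open>A period \<open>p\<close> makes \<open>N - p\<close> a long match for \<open>N\<close>.
  The match at \<open>e\<close> given by the rule is as long, so the letters \<open>p\<close> places
  before \<open>e\<close> and \<open>N\<close> coincide; the period carries this to \<open>e\<close>
  and \<open>N\<close>, which should differ.\<close>

lemma em_rule_not_periodic:
  assumes "em_rule w (- d) z" "d \<ge> 0" "z \<ge> 0" "p \<ge> 1"
  shows "\<exists>t\<ge>0. w t \<noteq> w (t + p)"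
proof (rule ccontr)
  assume "\<not> ?thesis"
  then have per: "w t = w (t + p)" if "t \<ge> 0" for t
    using that by blast
  \<comment> \<open>The match at \<open>e\<close> may start \<open>d\<close> letters inside the
    seed; this size still gives \<open>e - p \<ge> 0\<close>.\<close>
  define N where "N = 3 * p + d + z"
  have "agree w (- d) (N - p) N (N - p)"
    unfolding agree_def
  proof (intro conjI allI impI)
    fix t assume "1 \<le> t \<and> t \<le> N - p"
    then show "w (N - p - t) = w (N - t)"
      using per[of "N - p - t"] by (simp add: algebra_simps)
  qed (use assms in simp)
  moreover have "N > z" "N - p < N" "N - p \<ge> 0"
    using assms by (auto simp: N_def)
  ultimately obtain e where e: "e < N" "agree w (- d) e N (N - p)" "w e \<noteq> w N"
    using em_ruleE[OF assms(1)] by metis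
  have "e - p \<ge> 0" "p \<le> N - p" "N - p \<ge> 0"
    using e(2) assms unfolding agree_def N_def by auto
  then have "w (e - p) = w (N - p)" "w (e - p) = w e" "w (N - p) = w N"
    using agreeD[OF e(2), of p] per[of "e - p"] per[of "N - p"] assms(4) by auto
  with e(3) show False by simp
qed

section \<open>Uniform non-periodicity\<close>

text \<open>This forbids equal factors longer than \<open>L\<close> at two different starts between
  \<open>-D\<close> and 0. Only nonnegative positions are compared, so the property passes from one
  seed to the other.\<close>

definition shift_free :: "(int \<Rightarrow> 'a) \<Rightarrow> int \<Rightarrow> int \<Rightarrow> bool" where
  "shift_free w D L \<longleftrightarrow> (\<forall>i i' n. n \<ge> L \<and> \<bar>i\<bar> \<le> D \<and> \<bar>i'\<bar> \<le> D \<and> i \<noteq> i' \<longrightarrow>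
     (\<exists>s. s \<le> n \<and> i + s \<ge> 0 \<and> i' + s \<ge> 0 \<and> w (i + s) \<noteq> w (i' + s)))"

lemma shift_freeE:
  assumes "shift_free w D L" "n \<ge> L" "\<bar>i\<bar> \<le> D" "\<bar>i'\<bar> \<le> D" "i \<noteq> i'"
  obtains s where "s \<le> n" "i + s \<ge> 0" "i' + s \<ge> 0" "w (i + s) \<noteq> w (i' + s)"
  using assms unfolding shift_free_def by meson

text \<open>Only the periods from 1 to \<open>2 * D\<close> matter, so one bound covers a failure of
  each.\<close>

lemma shift_free_exists:
  assumes np: "\<And>p. p \<ge> 1 \<Longrightarrow> \<exists>t\<ge>0. w t \<noteq> w (t + p)"
  obtains L :: int where "shift_free w D L"
proof -
  from np obtain f where f: "f p \<ge> 0 \<and> w (f p) \<noteq> w (f p + p)" if "p \<ge> 1" for p :: int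
    by metis
  define F where "F = Max (insert 0 (f ` {1..2 * D}))"
  have F: "f p \<le> F" if "1 \<le> p" "p \<le> 2 * D" for p
    unfolding F_def using that by (intro Max_ge) auto
  have *: "\<exists>s. s \<le> n \<and> i + s \<ge> 0 \<and> i' + s \<ge> 0 \<and> w (i + s) \<noteq> w (i' + s)"
    if "n \<ge> F + D" "\<bar>i\<bar> \<le> D" "\<bar>i'\<bar> \<le> D" "i < i'" for i i' n
  \<comment> \<open>This \<open>s\<close> moves \<open>i\<close> and \<open>i'\<close> to the two
    places where the period \<open>i' - i\<close> fails.\<close>
  proof (intro exI[of _ "f (i' - i) - i"] conjI)
    have p: "1 \<le> i' - i" "i' - i \<le> 2 * D" using that by linarith+
    show "f (i' - i) - i \<le> n" using F[OF p] that by linarith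
    show "0 \<le> i + (f (i' - i) - i)" "0 \<le> i' + (f (i' - i) - i)"
      using f[OF p(1)] p by linarith+
    show "w (i + (f (i' - i) - i)) \<noteq> w (i' + (f (i' - i) - i))"
      using f[OF p(1)] by (simp add: algebra_simps)
  qed
  have "shift_free w D (F + D)"
    unfolding shift_free_def
  proof (intro allI impI, elim conjE)
    fix i i' n :: int
    assume "n \<ge> F + D" "\<bar>i\<bar> \<le> D" "\<bar>i'\<bar> \<le> D" "i \<noteq> i'"
    then show "\<exists>s. s \<le> n \<and> i + s \<ge> 0 \<and> i' + s \<ge> 0 \<and> w (i + s) \<noteq> w (i' + s)"
      using *[of n i i'] *[of n i' i] by (metis linorder_neqE)
  qed
  then show thesis by (rule that)
qed

section \<open>First repeated factors\<close>

text \<open>\<open>j\<close> and \<open>k\<close> are the positions just after the two occurrences,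
  so \<open>j = n\<close> says that the prefix of length \<open>n\<close> is repeated.\<close>

definition first_repeat :: "(int \<Rightarrow> 'a) \<Rightarrow> int \<Rightarrow> int \<Rightarrow> bool" where
  "first_repeat w n k \<longleftrightarrow> (\<exists>j<k. agree w 0 j k n) \<and> (\<forall>k'<k. \<forall>j<k'. \<not> agree w 0 j k' n)"

text \<open>Pigeonhole: finitely many words have length \<open>n\<close>, so two starting positions
  share a factor; then take the least end.\<close>

lemma first_repeat_exists:
  fixes w :: "int \<Rightarrow> 'a :: finite"
  assumes "n \<ge> 0"
  obtains k where "first_repeat w n k"
proof -
  define code where "code i = map (\<lambda>t. w (int i + int t)) [0..<nat n]" for i :: nat
  have "range code \<subseteq> {xs. set xs \<subseteq> UNIV \<and> length xs = nat n}"
    by (auto simp: code_def)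
  then have "finite (range code)"
    by (rule finite_subset) (rule finite_lists_length_eq, simp)
  then have "\<not> inj code"
    using finite_imageD infinite_UNIV_nat by blast
  then obtain a b where ab: "a < b" "code a = code b"
    unfolding inj_def by (metis linorder_neqE_nat)
  have eq: "w (int a + int t) = w (int b + int t)" if "t < nat n" for t
    using arg_cong[OF ab(2), of "\<lambda>xs. xs ! t"] that by (simp add: code_def)
  have "agree w 0 (int a + n) (int b + n) n"
    unfolding agree_def
  proof (intro conjI allI impI)
    fix t assume "1 \<le> t \<and> t \<le> n"
    then show "w (int a + n - t) = w (int b + n - t)"
      using eq[of "nat (n - t)"] by (simp add: algebra_simps)
  qed simp
  then have ex: "\<exists>m. \<exists>j<int m. agree w 0 j (int m) n"
    using ab assms by (intro exI[of _ "b + nat n"]) (auto intro!: exI[of _ "int a + n"])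
  define m where "m = (LEAST m. \<exists>j<int m. agree w 0 j (int m) n)"
  have "\<exists>j<int m. agree w 0 j (int m) n"
    unfolding m_def using ex by (rule LeastI_ex)
  moreover have "\<not> agree w 0 j k' n" if "k' < int m" "j < k'" for j k'
  proof
    assume ag: "agree w 0 j k' n"
    then have "k' \<ge> 0" using that assms unfolding agree_def by auto
    then have "m \<le> nat k'"
      unfolding m_def using ag that by (intro Least_le) auto
    with that \<open>k' \<ge> 0\<close> show False by linarith
  qed
  ultimately have "first_repeat w n (int m)"
    unfolding first_repeat_def by blast
  then show thesis by (rule that)
qed

section \<open>Comparing two seeds\<close>

text \<open>\<open>z\<close> is the length of \<open>V\<close>; \<open>d1\<close> and
  \<open>d2\<close> count the seed letters left of it. Taking \<open>d1\<close> positive loses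
  nothing for different seeds, which may be exchanged.\<close>

locale two_seeds =
  fixes w1 w2 :: "int \<Rightarrow> bool" and d1 d2 z :: int
  assumes d1: "d1 \<ge> 1" and d2: "d2 \<ge> 0" and z: "z \<ge> 0"
    and eq: "\<And>t. t \<ge> 0 \<Longrightarrow> w1 t = w2 t"
    and diff: "d2 \<ge> 1 \<Longrightarrow> w1 (- 1) \<noteq> w2 (- 1)"
    and em1: "em_rule w1 (- d1) z" and em2: "em_rule w2 (- d2) z"
begin

lemma agree_eq: "N - l \<ge> 0 \<Longrightarrow> agree w1 0 e N l = agree w2 0 e N l"
  unfolding agree_def using eq by (auto; smt (verit))

lemma first_repeat_eq: "n \<ge> 0 \<Longrightarrow> first_repeat w1 n k = first_repeat w2 n k"
proof -
  have "(j < k \<and> agree w1 0 j k n) = (j < k \<and> agree w2 0 j k n)" for j k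
    using agree_eq[of k n j] unfolding agree_def by auto
  then show ?thesis unfolding first_repeat_def by blast
qed

text \<open>At the letter completing the first repeat, the previous \<open>n - 1\<close> letters already had an
  earlier occurrence followed by the other letter. Inside the common part a third occurrence
  would produce an even earlier repeat, so both matches cross into the seeds, where the two
  words differ.\<close>

lemma first_repeat_prefix:
  assumes L: "shift_free w1 (d1 + d2) L"
    and n: "n > L" "n > z + d1 + d2 + 1"
    and k: "first_repeat w1 n k" and j: "j < k" "agree w1 0 j k n"
  shows "j = n"
proof (rule ccontr)
  assume "j \<noteq> n"
  with j have jn: "j > n" unfolding agree_def by auto
  \<comment> \<open>These are the last letters of the two occurrences; the rule is applied at
    \<open>N\<close> to the \<open>n - 1\<close> letters before it.\<close>
  define N e where "N = k - 1" and "e = j - 1"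
  have eN: "e < N" "e \<ge> n" "n > 0" using j jn d1 d2 z n by (auto simp: N_def e_def)
  have we: "w1 e = w1 N"
    using agreeD[OF j(2), of 1] eN by (simp add: N_def e_def)
  have ae: "agree w1 0 e N (n - 1)"
    unfolding agree_def
  proof (intro conjI allI impI)
    fix t assume "1 \<le> t \<and> t \<le> n - 1"
    then show "w1 (e - t) = w1 (N - t)"
      using agreeD[OF j(2), of "t + 1"] by (simp add: N_def e_def algebra_simps)
  qed (use eN in simp)
  have no: "\<not> agree w1 0 a b n" if "a < b" "b \<le> N" for a b
    using k that unfolding first_repeat_def N_def by auto
  have le: "w1 (e - n) \<noteq> w1 (N - n)"
    using agree_extend[OF ae] no[of e N] eN by auto
  have cross: "e' \<le> n - 1" if e': "e' < N" "agree w1 (- d1) e' N (n - 1)" "w1 e' \<noteq> w1 N"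
    for e'
  proof (rule ccontr)
    assume "\<not> e' \<le> n - 1"
    then have e'n: "e' \<ge> n" by simp
    then have ag: "agree w1 0 e' N (n - 1)" and ne: "e' \<noteq> e"
      using e' we by (auto simp: agree_def)
    have "w1 (e' - n) \<noteq> w1 (N - n)"
      using agree_extend[OF ag] no[of e' N] e' e'n by auto
    \<comment> \<open>Over two letters, differing from the same letter means being equal; so a
      factor of length \<open>n\<close> ends before both \<open>e\<close> and \<open>e'\<close>, too
      early for \<open>k\<close>.\<close>
    then have "w1 (e' - n) = w1 (e - n)" using le by auto
    then have "agree w1 0 e e' n" "agree w1 0 e' e n"
      using agree_extend[OF agree_common[OF ae ag]] agree_extend[OF agree_common[OF ag ae]] eN e'n
      by auto
    with no[of e e'] no[of e' e] ne e' eN show False by linarith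
  qed
  have ae2: "agree w2 0 e N (n - 1)"
    using ae agree_eq[of N "n - 1" e] eN by auto
  obtain e1 where e1: "e1 < N" "agree w1 (- d1) e1 N (n - 1)" "w1 e1 \<noteq> w1 N"
    "e \<le> e1 \<or> agree w1 (- d1) e1 N (n - 1 + 1)"
    by (rule em_ruleE[OF em1, of N e "n - 1"])
       (use eN n z d1 d2 agree_mono[OF ae, of "- d1" "n - 1"] in auto)
  obtain e2 where e2: "e2 < N" "agree w2 (- d2) e2 N (n - 1)" "w2 e2 \<noteq> w2 N"
    "e \<le> e2 \<or> agree w2 (- d2) e2 N (n - 1 + 1)"
    by (rule em_ruleE[OF em2, of N e "n - 1"])
       (use eN n z d1 d2 agree_mono[OF ae2, of "- d2" "n - 1"] in auto)
  have "e1 \<le> n - 1"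
    using cross e1 by simp
  \<comment> \<open>As \<open>e1 < n \<le> e\<close>, the rule must have found a longer
    match.\<close>
  then have a1: "agree w1 (- d1) e1 N n" using e1(4) eN by auto
  have "e2 \<le> n - 1"
  proof (rule ccontr)
    assume "\<not> e2 \<le> n - 1"
    then have "agree w2 0 e2 N (n - 1)" "e2 \<ge> n" using e2(2) unfolding agree_def by auto
    then have "agree w1 0 e2 N (n - 1)" "w1 e2 \<noteq> w1 N"
      using agree_eq[of N "n - 1" e2] eN e2(3) eq[of e2] eq[of N] by auto
    with cross[of e2] agree_mono[of w1 0 e2 N "n - 1" "- d1" "n - 1"] d1 e2(1) \<open>\<not> e2 \<le> n - 1\<close> show False by auto
  qed
  then have a2: "agree w2 (- d2) e2 N n" using e2(4) eN by auto
  have same: "w1 (e1 - t) = w2 (e2 - t)" if "1 \<le> t" "t \<le> n" for t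
    using agreeD[OF a1 that] agreeD[OF a2 that] eq[of "N - t"] that eN by auto
  have b: "e1 - n \<ge> - d1" "e2 - n \<ge> - d2" using a1 a2 unfolding agree_def by auto
  show False
  \<comment> \<open>Equal ends make both matches cover position \<open>-1\<close>, where the seeds
    differ; distinct ends give distinct starts near 0 for the same factor.\<close>
  proof (cases "e1 = e2")
    case True
    then have "w1 (- 1) = w2 (- 1)"
      using same[of "e1 + 1"] b n d1 d2 z \<open>e1 \<le> n - 1\<close> by auto
    then show False using diff b \<open>e2 \<le> n - 1\<close> by auto
  next
    case False
    obtain s where s: "s \<le> n - 1" "e1 - n + s \<ge> 0" "e2 - n + s \<ge> 0"
      "w1 (e1 - n + s) \<noteq> w1 (e2 - n + s)"
      by (rule shift_freeE[OF L, of "n - 1" "e1 - n" "e2 - n"])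
        (use n b False d1 d2 \<open>e1 \<le> n - 1\<close> \<open>e2 \<le> n - 1\<close> in auto)
    have "s \<ge> 0" using s(2) \<open>e1 \<le> n - 1\<close> by linarith
    then have "w1 (e1 - n + s) = w2 (e2 - n + s)"
      using same[of "n - s"] s(1) by (simp add: algebra_simps)
    then show False using s eq by auto
  qed
qed

end

text \<open>Otherwise the repeat would extend to the left, so that the only earlier match is at the
  beginning of the common part, and the rule would break the repeat off.\<close>

lemma first_repeat_left_letter:
  assumes em: "em_rule w (- d) z" and d: "d \<ge> 1" "z \<ge> 0" "d \<le> D"
    and L: "shift_free w D L"
    and n: "n > L" "n > z + D + 1"
    and k: "first_repeat w n k" "n < k" "agree w 0 n k n"
  shows "w (k - n - 1) \<noteq> w (- 1)"
proof
  assume l: "w (k - n - 1) = w (- 1)"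
  define N where "N = k - 1"
  have pre: "w (n - 1 - t) = w (N - t)" if "0 \<le> t" "t \<le> n - 1" for t
    using agreeD[OF k(3), of "t + 1"] that by (simp add: N_def algebra_simps)
  \<comment> \<open>By \<open>l\<close> the repeat extends one letter into the seed, so the
    \<open>n\<close> letters before \<open>N\<close> also start at \<open>-1\<close>.\<close>
  have ag: "agree w (- d) (n - 1) N n"
    unfolding agree_def
  proof (intro conjI allI impI)
    fix t assume t: "1 \<le> t \<and> t \<le> n"
    show "w (n - 1 - t) = w (N - t)"
    proof (cases "t = n")
      case True
      then show ?thesis using l by (simp add: N_def algebra_simps)
    qed (use t pre in auto)
  qed (use d in simp)
  obtain e where e: "e < N" "agree w (- d) e N n" "w e \<noteq> w N"
    by (rule em_ruleE[OF em, of N "n - 1" n]) (use ag n d k in \<open>auto simp: N_def\<close>)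
  have "e \<noteq> n - 1" using e(3) pre[of 0] n d by auto
  have "\<not> agree w 0 e N n"
    using k(1) e(1) unfolding first_repeat_def N_def by auto
  then have "e < n" "e - n \<ge> - d" using e(2) unfolding agree_def by auto
  \<comment> \<open>The same \<open>n\<close> letters start at \<open>e - n\<close> and at
    \<open>-1\<close>, which are distinct and negative.\<close>
  then obtain s where s: "s \<le> n - 1" "e - n + s \<ge> 0" "-1 + s \<ge> 0"
      "w (e - n + s) \<noteq> w (-1 + s)"
    using shift_freeE[OF L, of "n - 1" "e - n" "-1"] n d \<open>e \<noteq> n - 1\<close> by auto
  have "w (e - n + s) = w (-1 + s)"
    using agreeD[OF e(2), of "n - s"] agreeD[OF ag, of "n - s"] s by (simp add: algebra_simps)
  with s show False by simp
qed

context two_seeds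
begin

lemma inconsistent: False
proof -
  obtain L :: int where L: "shift_free w1 (d1 + d2) L"
    using shift_free_exists[of w1 "d1 + d2"] em_rule_not_periodic[OF em1 _ z] d1 by force
  then have L2: "shift_free w2 (d1 + d2) L"
    unfolding shift_free_def using eq by metis
  define n where "n = max L (max 0 (z + d1 + d2 + 1)) + 1"
  have n: "n > L" "n > z + d1 + d2 + 1" "n > 0" by (auto simp: n_def)
  obtain k where k: "first_repeat w1 n k"
    using first_repeat_exists[of n w1] n by auto
  then obtain j where "j < k" "agree w1 0 j k n" unfolding first_repeat_def by auto
  with first_repeat_prefix[OF L n(1,2) k] have kn: "n < k" "agree w1 0 n k n" by auto
  have left: "w1 (k - n - 1) \<noteq> w1 (- 1)"
    by (rule first_repeat_left_letter[OF em1 d1 z _ L _ _ k kn]) (use n d2 in auto)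
  show False
  proof (cases "d2 \<ge> 1")
    case True
    have "w2 (k - n - 1) \<noteq> w2 (- 1)"
    proof (rule first_repeat_left_letter[OF em2 True z _ L2])
      show "first_repeat w2 n k" using k first_repeat_eq n by auto
      show "agree w2 0 n k n" using kn agree_eq[of k n n] by auto
    qed (use n d1 kn in auto)
    then show False using left diff[OF True] eq[of "k - n - 1"] kn by auto
  next
    case False
    then have d20: "d2 = 0" using d2 by simp
    obtain k' where k': "first_repeat w1 (n + 1) k'"
      using first_repeat_exists[of "n + 1" w1] n by auto
    then obtain j' where "j' < k'" "agree w1 0 j' k' (n + 1)" unfolding first_repeat_def by auto
    with first_repeat_prefix[OF L _ _ k'] n have kn': "n + 1 < k'" "agree w1 0 (n + 1) k' (n + 1)"
      by auto
    have left': "w1 (k' - (n + 1) - 1) \<noteq> w1 (- 1)"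
      by (rule first_repeat_left_letter[OF em1 d1 z _ L _ _ k' kn']) (use n d2 in auto)
    define N where "N = k' - 1"
    have ag: "agree w1 0 n N n"
      unfolding agree_def
    proof (intro conjI allI impI)
      fix t assume "1 \<le> t \<and> t \<le> n"
      then show "w1 (n - t) = w1 (N - t)"
        using agreeD[OF kn'(2), of "t + 1"] by (simp add: N_def algebra_simps)
    qed simp
    have wn: "w1 n = w1 N" using agreeD[OF kn'(2), of 1] n by (simp add: N_def)
    have nN: "n < N" using kn' by (simp add: N_def)
    \<comment> \<open>The second word starts at 0, so this match lies in the common part. It is a
      further occurrence of the prefix: the letter after it differs from the one at
      \<open>N\<close>, while \<open>w1 n\<close> does not.\<close>
    obtain e where e: "e < N" "agree w2 0 e N n" "w2 e \<noteq> w2 N"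
      by (rule em_ruleE[OF em2, of N n n])
        (use nN n d1 d20 z ag agree_eq[of N n n] in auto)
    have "n \<le> e" using e unfolding agree_def by auto
    moreover have "n \<noteq> e" using e(3) wn eq n nN by auto
    ultimately have "n < e" by simp
    moreover have "agree w1 0 n e n"
      using agree_common[OF ag, of e] e(2) agree_eq[of N n e] nN by auto
    \<comment> \<open>The prefix of length \<open>n\<close> ends before both \<open>n\<close> and
      \<open>e\<close>, so its first repeat is complete by \<open>e\<close>.\<close>
    ultimately have "k \<le> e"
      using k unfolding first_repeat_def by (meson not_le)
    then have "k < N" using e by simp
    have "agree w1 0 k N n"
      using kn ag unfolding agree_def by auto
    \<comment> \<open>Both letters differ from \<open>w1 (- 1)\<close>, hence they are
      equal.\<close>
    moreover have "w1 (k - (n + 1)) = w1 (N - (n + 1))"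
      using left left' by (auto simp: N_def algebra_simps)
    ultimately have "agree w1 0 k N (n + 1)"
      using kn by (intro agree_extend) auto
    with k' \<open>k < N\<close> show False unfolding first_repeat_def N_def by auto
  qed
qed

end

section \<open>From the list definitions to the rule\<close>

lemma occurs_at_iff:
  "occurs_at u i w \<longleftrightarrow> i + length u \<le> length w \<and> (\<forall>t<length u. w ! (i + t) = u ! t)"
proof
  assume "occurs_at u i w"
  then show "i + length u \<le> length w \<and> (\<forall>t<length u. w ! (i + t) = u ! t)"
    unfolding occurs_at_def by (auto simp: nth_append)
next
  assume *: "i + length u \<le> length w \<and> (\<forall>t<length u. w ! (i + t) = u ! t)"
  then have "take (length u) (drop i w) = u"
    by (intro nth_equalityI) auto
  then have "w = take i w @ u @ drop (length u) (drop i w)"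
    by (metis append_take_drop_id)
  moreover have "length (take i w) = i" using * by simp
  ultimately show "occurs_at u i w" unfolding occurs_at_def by blast
qed

lemma sublist_iff_occurs_at: "sublist u w \<longleftrightarrow> (\<exists>i. occurs_at u i w)"
  unfolding sublist_def occurs_at_def by auto

text \<open>The maximum is attained: the empty string is a candidate and lengths are bounded by that
  of \<open>W\<close>.\<close>

lemma em_tail:
  assumes "W \<noteq> []"
  shows "suffix (em_tail W) W" "sublist (em_tail W) (butlast W)"
    "\<And>s. suffix s W \<Longrightarrow> sublist s (butlast W) \<Longrightarrow> length s \<le> length (em_tail W)"
proof -
  let ?P = "\<lambda>s. suffix s W \<and> sublist s (butlast W)"
  have "?P []" by simp
  moreover have "\<forall>s. ?P s \<longrightarrow> length s < length W + 1"
    by (auto dest: suffix_length_le)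
  ultimately have "?P (em_tail W) \<and> (\<forall>s. ?P s \<longrightarrow> length s \<le> length (em_tail W))"
    unfolding em_tail_def by (rule arg_max_nat_lemma)
  then show "suffix (em_tail W) W" "sublist (em_tail W) (butlast W)"
    "\<And>s. suffix s W \<Longrightarrow> sublist s (butlast W) \<Longrightarrow> length s \<le> length (em_tail W)"
    by auto
qed

lemma em_pos:
  assumes "W \<noteq> []"
  shows "occurs_at (em_tail W) (em_pos W) (butlast W)"
    "\<And>i. occurs_at (em_tail W) i (butlast W) \<Longrightarrow> i \<le> em_pos W"
proof -
  have b: "\<And>i. occurs_at (em_tail W) i (butlast W) \<Longrightarrow> i \<le> length W"
    by (auto simp: occurs_at_iff)
  obtain i where "occurs_at (em_tail W) i (butlast W)"
    using em_tail(2)[OF assms] by (auto simp: sublist_iff_occurs_at)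
  then show "occurs_at (em_tail W) (em_pos W) (butlast W)"
    unfolding em_pos_def by (rule GreatestI_nat) (rule b)
  show "i \<le> em_pos W" if "occurs_at (em_tail W) i (butlast W)" for i
    unfolding em_pos_def using that by (rule Greatest_le_nat) (rule b)
qed

text \<open>The list form of \<open>em_rule\<close>: maximality of the tail gives
  \<open>l \<le> l1\<close>, and on equality the choice of the latest occurrence gives
  \<open>e \<le> e1\<close>.\<close>

lemma em_next_rule:
  assumes "e < length W" "l \<le> e" "\<And>t. 1 \<le> t \<Longrightarrow> t \<le> l \<Longrightarrow> W ! (e - t) = W ! (length W - t)"
  obtains e1 l1 where "e1 < length W" "l1 \<le> e1" "em_next W = (\<not> W ! e1)"
    "\<And>t. 1 \<le> t \<Longrightarrow> t \<le> l1 \<Longrightarrow> W ! (e1 - t) = W ! (length W - t)"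
    "l < l1 \<or> l = l1 \<and> e \<le> e1"
proof -
  have W: "W \<noteq> []" using assms by auto
  define N where "N = length W"
  define l1 where "l1 = length (em_tail W)"
  define e1 where "e1 = em_pos W + l1"
  have tail: "em_tail W = drop (N - l1) W" and "l1 \<le> N"
    using em_tail(1)[OF W] unfolding suffix_def l1_def N_def
    by (metis append_eq_conv_conj diff_add_inverse2 length_append, simp add: suffix_length_le
        em_tail(1)[OF W])
  have pos: "em_pos W + l1 \<le> N - 1" "\<And>t. t < l1 \<Longrightarrow> butlast W ! (em_pos W + t) = em_tail W ! t"
    using em_pos(1)[OF W] by (auto simp: occurs_at_iff l1_def N_def)
  have e1: "e1 < N" "l1 \<le> e1" using pos(1) assms(1) by (auto simp: e1_def N_def)
  \<comment> \<open>The given match is a candidate for the tail; \<open>e < length W\<close> places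
    it inside \<open>butlast W\<close>.\<close>
  have occ: "occurs_at (drop (N - l) W) (e - l) (butlast W)"
    unfolding occurs_at_iff
  proof (intro conjI allI impI)
    show "e - l + length (drop (N - l) W) \<le> length (butlast W)"
      using assms by (auto simp: N_def)
    fix t assume "t < length (drop (N - l) W)"
    then have t: "t < l" using assms by (auto simp: N_def)
    then show "butlast W ! (e - l + t) = drop (N - l) W ! t"
      using assms(3)[of "l - t"] assms(1,2) by (auto simp: N_def nth_butlast)
  qed
  have "length (drop (N - l) W) \<le> length (em_tail W)"
    using occ by (intro em_tail(3)[OF W]) (auto simp: suffix_drop sublist_iff_occurs_at)
  then have l: "l \<le> l1" using assms by (auto simp: l1_def N_def)
  show thesis
  proof (rule that[of e1 l1])
    show "em_next W = (\<not> W ! e1)" using W by (simp add: em_next_def e1_def l1_def)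
    show "W ! (e1 - t) = W ! (length W - t)" if t: "1 \<le> t" "t \<le> l1" for t
    proof -
      have "butlast W ! (em_pos W + (l1 - t)) = em_tail W ! (l1 - t)"
        using t by (intro pos) auto
      moreover have "em_pos W + (l1 - t) = e1 - t" using t by (auto simp: e1_def)
      moreover have "em_tail W ! (l1 - t) = W ! (N - t)"
        using t \<open>l1 \<le> N\<close> by (subst tail) (auto simp: N_def)
      ultimately show ?thesis using e1 t by (simp add: nth_butlast N_def)
    qed
    show "l < l1 \<or> l = l1 \<and> e \<le> e1"
    proof (cases "l = l1")
      case True
      then have "e - l \<le> em_pos W" using occ tail by (intro em_pos(2)[OF W]) simp
      then show ?thesis using True assms by (auto simp: e1_def)
    qed (use l in auto)
  qed (use e1 in \<open>auto simp: N_def\<close>)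
qed

definition full_word :: "bool list \<Rightarrow> nat \<Rightarrow> bool" where
  "full_word Z i = (if i < length Z then Z ! i else EM Z (i - length Z))"

lemma em_word_eq: "em_word Z k = map (full_word Z) [0..<length Z + k]"
proof (induction k)
  case 0
  show ?case by (rule nth_equalityI) (auto simp: full_word_def)
next
  case (Suc k)
  have "em_next (em_word Z k) = full_word Z (length Z + k)"
    by (simp add: full_word_def EM_def)
  then show ?case using Suc by simp
qed

text \<open>List index \<open>i\<close> becomes position \<open>i - d\<close>, which puts the last
  \<open>z\<close> seed letters at 0 to \<open>z - 1\<close>.\<close>

lemma em_rule_full_word:
  assumes "length Z = d + z"
  shows "em_rule (\<lambda>t. full_word Z (nat (t + int d))) (- int d) (int z)"
  unfolding em_rule_def
proof (intro allI impI)
  let ?w = "\<lambda>t. full_word Z (nat (t + int d))"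
  fix N e l :: int
  assume N: "int z < N" and e: "e < N" and l: "0 \<le> l" and ag: "agree ?w (- int d) e N l"
  define m where "m = nat (N + int d)"
  define W where "W = em_word Z (m - length Z)"
  have m: "length Z < m" using N assms by (auto simp: m_def)
  have W: "length W = m" "\<And>i. i < m \<Longrightarrow> W ! i = full_word Z i"
    using m by (auto simp: W_def em_word_eq)
  have nxt: "em_next W = full_word Z m"
    using m by (simp add: W_def full_word_def EM_def)
  have el: "- int d \<le> e - l" using ag by (simp add: agree_def)
  have "W ! (nat (e + int d) - t) = W ! (length W - t)" if "1 \<le> t" "t \<le> nat l" for t
  proof -
    have "?w (e - int t) = ?w (N - int t)" using agreeD[OF ag, of "int t"] that by auto
    moreover have "nat (e - int t + int d) = nat (e + int d) - t" "nat (N - int t + int d) = m - t"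
      by (auto simp: m_def)
    moreover have "nat (e + int d) - t < m" "m - t < m"
      using that e el m l by (auto simp: m_def)
    ultimately show ?thesis using W by simp
  qed
  then obtain e1 l1 where e1: "e1 < m" "l1 \<le> e1" "full_word Z m = (\<not> W ! e1)"
    "\<And>t. 1 \<le> t \<Longrightarrow> t \<le> l1 \<Longrightarrow> W ! (e1 - t) = W ! (m - t)"
    "nat l < l1 \<or> nat l = l1 \<and> nat (e + int d) \<le> e1"
    using em_next_rule[of "nat (e + int d)" W "nat l"] e el l N W(1) nxt
    by (smt (verit) m_def nat_le_eq_zle nat_less_eq_zless)
  have ag1: "agree ?w (- int d) (int e1 - int d) N (int l1)"
    unfolding agree_def
  proof (intro conjI allI impI)
    fix t assume t: "1 \<le> t \<and> t \<le> int l1"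
    have "nat (int e1 - int d - t + int d) = e1 - nat t" "nat (N - t + int d) = m - nat t"
      using t N by (auto simp: m_def)
    moreover have "full_word Z (e1 - nat t) = full_word Z (m - nat t)"
    proof -
      have "1 \<le> nat t" "nat t \<le> l1" "e1 - nat t < m" "m - nat t < m"
        using t e1(1) by linarith+
      then show ?thesis
        using e1(4)[of "nat t"] W(2)[of "e1 - nat t"] W(2)[of "m - nat t"] by simp
    qed
    ultimately show "?w (int e1 - int d - t) = ?w (N - t)" by simp
  qed (use e1 in simp)
  show "\<exists>e1<N. agree ?w (- int d) e1 N l \<and> ?w e1 \<noteq> ?w N \<and>
      (e \<le> e1 \<or> agree ?w (- int d) e1 N (l + 1))"
  proof (intro exI[of _ "int e1 - int d"] conjI)
    show "int e1 - int d < N" using e1(1) by (auto simp: m_def)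
    show "agree ?w (- int d) (int e1 - int d) N l"
      using agree_mono[OF ag1] e1(5) l by auto
    show "?w (int e1 - int d) \<noteq> ?w N"
      using e1(1,3) W(2)[of e1] by (auto simp: m_def)
    show "e \<le> int e1 - int d \<or> agree ?w (- int d) (int e1 - int d) N (l + 1)"
    proof (cases "nat l < l1")
      case True
      then show ?thesis using agree_mono[OF ag1, of "- int d" "l + 1"] l by linarith
    next
      case False
      then show ?thesis using e1(5) by linarith
    qed
  qed
qed

section \<open>Splitting off the common suffix\<close>

lemma EM_neq:
  assumes eq: "EM (A @ V) = EM (B @ V)" and A: "A \<noteq> []" and B: "B \<noteq> [] \<Longrightarrow> last A \<noteq> last B"
  shows False
proof -
  let ?w = "\<lambda>A t. full_word (A @ V) (nat (t + int (length A)))"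
  interpret two_seeds "?w A" "?w B" "int (length A)" "int (length B)" "int (length V)"
  proof
    \<comment> \<open>At nonnegative positions the lookup skips \<open>A\<close> or \<open>B\<close>
      and lands in \<open>V\<close> or in the common sequence.\<close>
    show "?w A t = ?w B t" if "t \<ge> 0" for t
    proof -
      have "nat (t + int (length C)) = nat t + length C" for C :: "bool list"
        using that by auto
      then show ?thesis using eq by (simp add: full_word_def nth_append)
    qed
    show "?w A (- 1) \<noteq> ?w B (- 1)" if "int (length B) \<ge> 1"
    proof -
      have "?w C (- 1) = last C" if "C \<noteq> []" for C
      proof -
        have "nat (- 1 + int (length C)) = length C - 1" by auto
        then show ?thesis
          using that by (cases C) (auto simp: full_word_def nth_append last_conv_nth)
      qed
      moreover have "B \<noteq> []" using that by auto
      ultimately show ?thesis using A B by metis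
    qed
    show "1 \<le> int (length A)" using A by (cases A) auto
  qed (auto intro: em_rule_full_word)
  show False by (rule inconsistent)
qed

lemma longest_common_suffix_split:
  obtains A B V where "xs = A @ V" "ys = B @ V" "A = [] \<or> B = [] \<or> last A \<noteq> last B"
proof (induction xs arbitrary: ys thesis rule: rev_induct)
  case Nil
  show ?case by (rule Nil[of "[]" "[]" ys]) auto
next
  case (snoc x xs)
  show ?case
  proof (cases "ys \<noteq> [] \<and> last ys = x")
    case True
    obtain A B V where "xs = A @ V" "butlast ys = B @ V" "A = [] \<or> B = [] \<or> last A \<noteq> last B"
      using snoc.IH by blast
    moreover have "ys = butlast ys @ [x]"
      using True append_butlast_last_id by metis
    ultimately show ?thesis
      using snoc.prems[of A "V @ [x]" B] by (metis append_assoc)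
  next
    case False
    then show ?thesis by (intro snoc.prems[of "xs @ [x]" "[]" ys]) auto
  qed
qed

theorem theorem3p3:
  fixes Z1 Z2 :: "bool list"
  assumes "EM Z1 = EM Z2"
  shows "Z1 = Z2"
proof -
  obtain A B V where s: "Z1 = A @ V" "Z2 = B @ V" "A = [] \<or> B = [] \<or> last A \<noteq> last B"
    by (rule longest_common_suffix_split)
  \<comment> \<open>\<open>EM_neq\<close> wants its first left part nonempty, so the seeds are
    exchanged when \<open>A\<close> is empty and \<open>B\<close> is not.\<close>
  show ?thesis
    using EM_neq[of A V B] EM_neq[of B V A] assms s by (cases "A = []"; cases "B = []") auto
qed

end
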